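(* Let $f,g:[a,b]\to\mathbb R$ be continuous functions. Suppose that $D_{\alpha,\beta}[g](t)\ne0$ for all $t\in\,]a,b[$ and all $\alpha,\beta\in\mathbb R^+$ for which $D_{\alpha,\beta}[g](t)$ is defined. Then there exist $\bar\alpha,\bar\beta\in\mathbb R^+$ and $c\in\,]a,b[$ such that $$\frac{f(b)-f(a)}{g(b)-g(a)}=\frac{D_{\bar\alpha,\bar\beta}[f](c)}{D_{\bar\alpha,\bar\beta}[g](c)}.$$
   Context: For $f:[a,b]\to\mathbb R$ and $\alpha,\beta>0$ with $b-a>\max\{\alpha,\beta\}$, the $\alpha,\beta$-symmetric difference derivative is $D_{\alpha,\beta}[f](t)=\frac{f(t+\alpha)-f(t-\beta)}{\alpha+\beta}$, defined for $t\in[a,b]\setminus([a,a+\beta]\cup[b-\alpha,b])$. The displayed equation includes the assertions that $c$ lies in this domain for $\bar\alpha,\bar\beta$ and that both denominators are nonzero. $\mathbb R^+$ denotes the positive reals and $a<b$. *)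

theory Defs
  imports Complex_Main
begin

definition symdiff_deriv :: "real \<Rightarrow> real \<Rightarrow> (real \<Rightarrow> real) \<Rightarrow> real \<Rightarrow> real" where
  "symdiff_deriv \<alpha> \<beta> f t = (f (t + \<alpha>) - f (t - \<beta>)) / (\<alpha> + \<beta>)"

(* The quotient above is a total function of t; for f on [a,b] it is the symmetric
   difference derivative only where the following predicate holds. *)
definition symdiff_defined_at :: "real \<Rightarrow> real \<Rightarrow> real \<Rightarrow> real \<Rightarrow> real \<Rightarrow> bool" where
  "symdiff_defined_at a b \<alpha> \<beta> t \<longleftrightarrow>
     \<alpha> > 0 \<and> \<beta> > 0 \<and> b - a > max \<alpha> \<beta> \<and>
     t \<in> {a..b} - ({a..a + \<beta>} \<union> {b - \<alpha>..b})"

end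

(* The symmetric differences defined at t are exactly the difference quotients over pairs of points
   x < y of the open interval. A continuous function with equal values at the endpoints repeats a
   value inside: if it differs from the endpoint value at c, it attains the midway value on both
   sides of c. For g this contradicts the hypothesis, so g(a) and g(b) differ; for the Cauchy
   combination of f and g it yields the claim. *)
theory Submission
  imports Defs
begin

text \<open>The intermediate value theorem gives a point of the closed interval, in its increasing
  or decreasing form according to the order of \<open>h p\<close> and \<open>h q\<close>. The strict
  bounds on \<open>v\<close> rule out both endpoints.\<close>

lemma continuous_strictly_between:
  fixes h :: "real \<Rightarrow> real"
  assumes "p \<le> q" "continuous_on {p..q} h" "min (h p) (h q) < v" "v < max (h p) (h q)"
  obtains x where "p < x" "x < q" "h x = v"
proof -
  have "\<exists>x. p \<le> x \<and> x \<le> q \<and> h x = v"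
  proof (cases "h p \<le> h q")
    case True
    then show ?thesis using IVT'[of h p v q] assms by auto
  next
    case False
    then show ?thesis using IVT2'[of h q v p] assms by auto
  qed
  then obtain x where x: "p \<le> x" "x \<le> q" "h x = v" by blast
  then have "x \<noteq> p" "x \<noteq> q" using assms by auto
  with x that show thesis by force
qed

lemma equal_endpoints_imp_repeated_interior_value:
  fixes h :: "real \<Rightarrow> real"
  assumes "a < b" "continuous_on {a..b} h" "h a = h b"
  obtains x y where "a < x" "x < y" "y < b" "h x = h y"
proof (cases "\<forall>c\<in>{a<..<b}. h c = h a")
  case True
  obtain x where "a < x" "x < b" using dense \<open>a < b\<close> by blast
  moreover obtain y where "x < y" "y < b" using dense \<open>x < b\<close> by blast
  ultimately show thesis using that True by simp
next
  case False
  then obtain c where c: "a < c" "c < b" "h c \<noteq> h a" by auto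
  \<comment> \<open>Since \<open>h a = h b\<close>, this value lies strictly between the endpoint
    values of \<open>h\<close> on both \<open>{a..c}\<close> and \<open>{c..b}\<close>.\<close>
  define v where "v = (h a + h c) / 2"
  have v: "min (h a) (h c) < v" "v < max (h a) (h c)"
    using c(3) by (auto simp: v_def min_def max_def)
  have "continuous_on {a..c} h" "continuous_on {c..b} h"
    using assms(2) c by (auto intro: continuous_on_subset)
  then obtain x y where "a < x" "x < c" "h x = v" "c < y" "y < b" "h y = v"
    using continuous_strictly_between[of a c h v] continuous_strictly_between[of c b h v] v c assms(3)
    by (metis less_imp_le max.commute min.commute)
  then show thesis using that[of x y] by simp
qed

text \<open>Equal steps of half the length of \<open>{x..y}\<close>, taken from its midpoint, land
  exactly on \<open>x\<close> and \<open>y\<close>. Being in the domain amounts to both landing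
  points being strictly inside \<open>{a..b}\<close>.\<close>

lemma symdiff_midpoint:
  assumes "a < x" "x < y" "y < b"
  shows "symdiff_defined_at a b ((y - x) / 2) ((y - x) / 2) ((x + y) / 2)"
    and "symdiff_deriv ((y - x) / 2) ((y - x) / 2) f ((x + y) / 2) = (f y - f x) / (y - x)"
proof -
  have "(x + y) / 2 + (y - x) / 2 = y" "(x + y) / 2 - (y - x) / 2 = x"
    by (simp_all add: field_simps)
  then show "symdiff_deriv ((y - x) / 2) ((y - x) / 2) f ((x + y) / 2) = (f y - f x) / (y - x)"
    by (simp add: symdiff_deriv_def)
  show "symdiff_defined_at a b ((y - x) / 2) ((y - x) / 2) ((x + y) / 2)"
    using assms by (auto simp: symdiff_defined_at_def field_simps)
qed

theorem theorem5p3p15: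
  fixes f g :: "real \<Rightarrow> real" and a b :: real
  assumes "a < b"
    and "continuous_on {a..b} f"
    and "continuous_on {a..b} g"
    and "\<And>\<alpha> \<beta> t. \<alpha> > 0 \<Longrightarrow> \<beta> > 0 \<Longrightarrow> t \<in> {a<..<b} \<Longrightarrow>
           symdiff_defined_at a b \<alpha> \<beta> t \<Longrightarrow> symdiff_deriv \<alpha> \<beta> g t \<noteq> 0"
  shows "\<exists>\<alpha> \<beta> c. \<alpha> > 0 \<and> \<beta> > 0 \<and> c \<in> {a<..<b} \<and>
           symdiff_defined_at a b \<alpha> \<beta> c \<and>
           g b - g a \<noteq> 0 \<and> symdiff_deriv \<alpha> \<beta> g c \<noteq> 0 \<and>
           (f b - f a) / (g b - g a) = symdiff_deriv \<alpha> \<beta> f c / symdiff_deriv \<alpha> \<beta> g c"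
proof -
  have nz: "symdiff_deriv ((y - x) / 2) ((y - x) / 2) g ((x + y) / 2) \<noteq> 0"
    if "a < x" "x < y" "y < b" for x y
    using assms(4) symdiff_midpoint(1)[OF that] that by simp
  then have inj: "g x \<noteq> g y" if "a < x" "x < y" "y < b" for x y
    using symdiff_midpoint(2)[OF that, of g] that by fastforce
  \<comment> \<open>If \<open>g a = g b\<close>, then \<open>g\<close> would repeat a value at two
    interior points, against \<open>inj\<close>.\<close>
  then have gab: "g b - g a \<noteq> 0"
    using equal_endpoints_imp_repeated_interior_value[OF assms(1,3)] by (metis eq_iff_diff_eq_0)
  \<comment> \<open>The coefficients make both endpoint values equal to
    \<open>g b * f a - f b * g a\<close>.\<close>
  define h where "h t = (g b - g a) * f t - (f b - f a) * g t" for t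
  have "continuous_on {a..b} h"
    unfolding h_def by (intro continuous_intros assms)
  moreover have "h a = h b" by (simp add: h_def algebra_simps)
  ultimately obtain x y where xy: "a < x" "x < y" "y < b" "h x = h y"
    using equal_endpoints_imp_repeated_interior_value assms(1) by blast
  then have "(f b - f a) * (g y - g x) = (f y - f x) * (g b - g a)"
    by (simp add: h_def algebra_simps)
  then have "(f b - f a) / (g b - g a) = (f y - f x) / (g y - g x)"
    using gab inj[OF xy(1-3)] by (simp add: frac_eq_eq)
  \<comment> \<open>Both difference quotients have denominator \<open>y - x\<close>, which is
    nonzero and cancels.\<close>
  also have "\<dots> = symdiff_deriv ((y - x) / 2) ((y - x) / 2) f ((x + y) / 2)
      / symdiff_deriv ((y - x) / 2) ((y - x) / 2) g ((x + y) / 2)"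
    using xy by (simp add: symdiff_midpoint(2)[OF xy(1-3)])
  finally show ?thesis
    using xy gab nz[OF xy(1-3)] symdiff_midpoint(1)[OF xy(1-3)]
    by (intro exI[of _ "(y - x) / 2"] exI[of _ "(x + y) / 2"]) simp
qed

end
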